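(* Let $0<p\le1$, $q>1$, $\beta>0$, $\epsilon\ge0$, and let $k\ge1$ be an integer. Let $z_0$ be the unique zero in $[0,+\infty)$ of $f_{p,q}(z)=z^q-\beta^pk^{-\frac{q-p}{q}}z^p-\beta^pk^{-\frac{q-p}{q}}-1$, and let $\Psi:=\beta^p(1+z_0^p)+k^{\frac{q-p}{q}}$. Put $$T_1:=3^{2-2p}k^{\frac{2}{\min\{q,2\}}-\frac{2-2p}{q}}\left(\beta(1+z_0)k^{-\frac1p}+k^{-\frac1q}\right)^{2p},\qquad T_2:=k^{\frac{2}{\min\{q,2\}}-\frac{2q+2-2p}{q}}\Psi^2.$$ Let $\bm{A}\in\mathbb{R}^{m\times n}$ have restricted isometry constant $\delta_{2k}$ of order $2k$, and suppose that both $\delta_{2k}<\frac{1}{\sqrt{1+T_2}}$ and $\delta_{2k}<\frac{1}{\sqrt{1+T_1}}$. Define $$B_o:=\frac{2\epsilon\sqrt{1+\delta_{2k}}\left(1+k^{\frac{1}{\min\{q,2\}}-\frac{2-p+q}{2q}}\sqrt{\Psi}\right)}{1-\delta_{2k}\sqrt{1+T_2}},\qquad B_z:=\frac{2\epsilon\sqrt{1+\delta_{2k}}\left(1+k^{\frac{1}{\min\{q,2\}}-\frac{2-p+q}{2q}}\sqrt{\Psi}\right)}{1-\delta_{2k}\sqrt{1+T_1}}.$$ Then $B_o\le B_z$.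
   Context: The restricted isometry constant (RIC) $\delta_s$ of $\bm{A}$ is the smallest number such that $(1-\delta_s)\|\bm{u}\|_2^2\le\|\bm{A}\bm{u}\|_2^2\le(1+\delta_s)\|\bm{u}\|_2^2$ for all $\bm{u}$ with at most $s$ nonzero entries. It is known that $f_{p,q}$ has exactly one zero in $[0,+\infty)$. $B_o$ and $B_z$ are two upper bounds for the recovery error $\|\hat{\bm{x}}-\bm{x}\|_2$ of $\ell_p^p/\ell_q^p$ minimization with noise level $\epsilon$. *)

theory Defs
  imports "HOL-Analysis.Analysis"
begin

text \<open>The smallest admissible constant exists whenever \<^term>\<open>s \<ge> (1::nat)\<close>
  (lemma \<open>ric_minimal\<close>). For \<^term>\<open>s = (0::nat)\<close> every real number is admissible, so
  there is no smallest one and the value is unspecified.\<close>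

definition rip_bound :: "real^'n^'m \<Rightarrow> nat \<Rightarrow> real \<Rightarrow> bool" where
  "rip_bound A s d \<longleftrightarrow>
     (\<forall>u :: real^'n. card {i. u $ i \<noteq> 0} \<le> s \<longrightarrow>
        (1 - d) * (norm u)\<^sup>2 \<le> (norm (A *v u))\<^sup>2 \<and>
        (norm (A *v u))\<^sup>2 \<le> (1 + d) * (norm u)\<^sup>2)"

definition ric :: "real^'n^'m \<Rightarrow> nat \<Rightarrow> real" where
  "ric A s = (LEAST d. rip_bound A s d)"

definition f_pq :: "real \<Rightarrow> real \<Rightarrow> real \<Rightarrow> nat \<Rightarrow> real \<Rightarrow> real" where
  "f_pq p q \<beta> k z =
     z powr q - \<beta> powr p * real k powr (- ((q - p) / q)) * z powr p
       - \<beta> powr p * real k powr (- ((q - p) / q)) - 1"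

definition z0 :: "real \<Rightarrow> real \<Rightarrow> real \<Rightarrow> nat \<Rightarrow> real" where
  "z0 p q \<beta> k = (THE z. 0 \<le> z \<and> f_pq p q \<beta> k z = 0)"

definition Psi :: "real \<Rightarrow> real \<Rightarrow> real \<Rightarrow> nat \<Rightarrow> real" where
  "Psi p q \<beta> k = \<beta> powr p * (1 + z0 p q \<beta> k powr p) + real k powr ((q - p) / q)"

definition T1 :: "real \<Rightarrow> real \<Rightarrow> real \<Rightarrow> nat \<Rightarrow> real" where
  "T1 p q \<beta> k =
     3 powr (2 - 2 * p) * real k powr (2 / min q 2 - (2 - 2 * p) / q) *
     (\<beta> * (1 + z0 p q \<beta> k) * real k powr (- (1 / p)) + real k powr (- (1 / q))) powr (2 * p)"

definition T2 :: "real \<Rightarrow> real \<Rightarrow> real \<Rightarrow> nat \<Rightarrow> real" where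
  "T2 p q \<beta> k = real k powr (2 / min q 2 - (2 * q + 2 - 2 * p) / q) * (Psi p q \<beta> k)\<^sup>2"

definition B_o :: "real \<Rightarrow> real \<Rightarrow> real \<Rightarrow> nat \<Rightarrow> real \<Rightarrow> real^'n^'m \<Rightarrow> real" where
  "B_o p q \<beta> k \<epsilon> A =
     2 * \<epsilon> * sqrt (1 + ric A (2 * k)) *
       (1 + real k powr (1 / min q 2 - (2 - p + q) / (2 * q)) * sqrt (Psi p q \<beta> k)) /
     (1 - ric A (2 * k) * sqrt (1 + T2 p q \<beta> k))"

definition B_z :: "real \<Rightarrow> real \<Rightarrow> real \<Rightarrow> nat \<Rightarrow> real \<Rightarrow> real^'n^'m \<Rightarrow> real" where
  "B_z p q \<beta> k \<epsilon> A =
     2 * \<epsilon> * sqrt (1 + ric A (2 * k)) *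
       (1 + real k powr (1 / min q 2 - (2 - p + q) / (2 * q)) * sqrt (Psi p q \<beta> k)) /
     (1 - ric A (2 * k) * sqrt (1 + T1 p q \<beta> k))"


lemma rip_bound_nonneg:
  fixes A :: "real^'n^'m"
  assumes "1 \<le> s" "rip_bound A s d"
  shows "0 \<le> d"
proof -
  fix i :: 'n
  have "{j. axis i (1::real) $ j \<noteq> 0} = {i}" by (auto simp: axis_def)
  then have "card {j. axis i (1::real) $ j \<noteq> 0} \<le> s" using assms(1) by simp
  then have "(1 - d) * (norm (axis i (1::real)))\<^sup>2 \<le> (1 + d) * (norm (axis i (1::real)))\<^sup>2"
    using assms(2) unfolding rip_bound_def by (meson order_trans)
  then show ?thesis by (simp add: norm_axis_1)
qed

lemma rip_bound_exists:
  fixes A :: "real^'n^'m"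
  shows "\<exists>d. rip_bound A s d"
proof -
  define C where "C = onorm ((*v) A)"
  have "rip_bound A s (1 + C\<^sup>2)"
    unfolding rip_bound_def
  proof (intro allI impI conjI)
    fix u :: "real^'n"
    have n: "norm (A *v u) \<le> C * norm u"
      unfolding C_def by (rule onorm) (rule matrix_vector_mul_bounded_linear)
    have "(norm (A *v u))\<^sup>2 \<le> (C * norm u)\<^sup>2"
      by (rule power_mono[OF n]) simp
    also have "\<dots> = C\<^sup>2 * (norm u)\<^sup>2" by (simp add: power_mult_distrib)
    also have "\<dots> \<le> (1 + (1 + C\<^sup>2)) * (norm u)\<^sup>2"
      by (rule mult_right_mono) auto
    finally show "(norm (A *v u))\<^sup>2 \<le> (1 + (1 + C\<^sup>2)) * (norm u)\<^sup>2" .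
    have "(1 - (1 + C\<^sup>2)) * (norm u)\<^sup>2 \<le> 0"
      by (rule mult_nonpos_nonneg) auto
    also have "\<dots> \<le> (norm (A *v u))\<^sup>2" by simp
    finally show "(1 - (1 + C\<^sup>2)) * (norm u)\<^sup>2 \<le> (norm (A *v u))\<^sup>2" .
  qed
  then show ?thesis by blast
qed

lemma ric_minimal:
  fixes A :: "real^'n^'m"
  assumes "1 \<le> s"
  shows "rip_bound A s (ric A s)" "\<And>d. rip_bound A s d \<Longrightarrow> ric A s \<le> d"
proof -
  let ?S = "{d. rip_bound A s d}"
  have ne: "?S \<noteq> {}" using rip_bound_exists by blast
  have bd: "bdd_below ?S" using rip_bound_nonneg[OF assms] by (auto intro!: bdd_belowI[of _ 0])
  have cl: "closed ?S"
    unfolding rip_bound_def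
    by (intro closed_Collect_all closed_Collect_imp closed_Collect_conj closed_Collect_le
        continuous_intros) auto
  have "Inf ?S \<in> ?S" using closed_contains_Inf[OF ne bd cl] .
  then have m: "rip_bound A s (Inf ?S)" by simp
  have l: "\<And>d. rip_bound A s d \<Longrightarrow> Inf ?S \<le> d" using cInf_lower[OF _ bd] by blast
  have eq: "ric A s = Inf ?S"
    unfolding ric_def by (rule Least_equality) (use m l in auto)
  show "rip_bound A s (ric A s)" using m eq by simp
  show "\<And>d. rip_bound A s d \<Longrightarrow> ric A s \<le> d" using l eq by simp
qed

lemma f_pq_ex1_zero:
  assumes "0 < p" "p \<le> 1" "1 < q" "0 < \<beta>" "1 \<le> k"
  shows "\<exists>!z. 0 \<le> z \<and> f_pq p q \<beta> k z = 0"
proof -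
  define c where "c = \<beta> powr p * real k powr (- ((q - p) / q))"
  have c: "0 < c" using assms by (simp add: c_def)
  have f: "f_pq p q \<beta> k z = z powr q - c * z powr p - c - 1" for z
    by (simp add: f_pq_def c_def)
  have qp: "0 < q - p" using assms by simp
  define Z where "Z = (2 * c + 1) powr (1 / (q - p))"
  have Z1: "1 \<le> Z" unfolding Z_def by (rule ge_one_powr_ge_zero) (use c qp in auto)
  have "Z powr q = Z powr p * Z powr (q - p)" by (simp add: powr_add[symmetric])
  also have "Z powr (q - p) = 2 * c + 1"
    unfolding Z_def using c qp by (simp add: powr_powr)
  finally have "f_pq p q \<beta> k Z = (c + 1) * (Z powr p - 1)"
    by (simp add: f algebra_simps)
  moreover have "1 \<le> Z powr p" using Z1 assms by (intro ge_one_powr_ge_zero) auto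
  ultimately have fZ: "0 \<le> f_pq p q \<beta> k Z" using c by simp
  have f0: "f_pq p q \<beta> k 0 \<le> 0" using c assms by (simp add: f)
  have "continuous_on {0..Z} (f_pq p q \<beta> k)"
    unfolding f using assms by (intro continuous_intros continuous_on_powr') auto
  then obtain z where z: "0 \<le> z" "f_pq p q \<beta> k z = 0"
    using IVT'[of "f_pq p q \<beta> k" 0 0 Z] f0 fZ Z1 by auto
  have lt: False if "0 \<le> a" "a < b" "f_pq p q \<beta> k a = 0" "f_pq p q \<beta> k b = 0" for a b
  proof -
    have "a \<noteq> 0" using that c assms by (auto simp: f)
    then have a: "0 < a" using that by simp
    then have b: "0 < b" using that by simp
    have g: "x powr (q - p) = c + (c + 1) * x powr (- p)"
      if "0 < x" "f_pq p q \<beta> k x = 0" for x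
    proof -
      have "x powr p * x powr (- p) = 1" using that by (simp add: powr_add[symmetric])
      moreover have "x powr (q - p) = x powr q * x powr (- p)" by (simp add: powr_add[symmetric])
      moreover have "x powr q = c * x powr p + c + 1" using that by (simp add: f)
      ultimately show ?thesis by (simp add: algebra_simps)
    qed
    have "a powr (q - p) < b powr (q - p)" using that qp by (intro powr_less_mono2) auto
    moreover have "b powr (- p) \<le> a powr (- p)"
      using that a assms by (intro powr_mono2') auto
    then have "(c + 1) * b powr (- p) \<le> (c + 1) * a powr (- p)"
      using c by (intro mult_left_mono) auto
    ultimately show False using g[OF a that(3)] g[OF b that(4)] by linarith
  qed
  show ?thesis
    using z lt by (metis linorder_neqE)
qed

lemma z0_zero:
  assumes "0 < p" "p \<le> 1" "1 < q" "0 < \<beta>" "1 \<le> k"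
  shows "0 \<le> z0 p q \<beta> k" "f_pq p q \<beta> k (z0 p q \<beta> k) = 0"
  using theI'[OF f_pq_ex1_zero[OF assms]] unfolding z0_def by auto

end

theory Submission
  imports Defs
begin

text \<open>After taking square roots and cancelling a power of \<^term>\<open>k\<close>, the inequality
  \<open>T\<^sub>2 \<le> T\<^sub>1\<close> is the power mean inequality
  \<open>x\<^sup>p + y\<^sup>p + w\<^sup>p \<le> 3\<^bsup>1-p\<^esup> (x + y + w)\<^sup>p\<close> for
  \<open>x = \<beta> k\<^bsup>-1/p\<^esup>\<close>, \<open>y = \<beta> z\<^sub>0 k\<^bsup>-1/p\<^esup>\<close>,
  \<open>w = k\<^bsup>-1/q\<^esup>\<close>, since \<open>x\<^sup>p + y\<^sup>p + w\<^sup>p = \<Psi> / k\<close>. As the numerators of both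
  bounds agree, the smaller denominator belongs to the larger bound.\<close>

text \<open>Weighted AM-GM for \<open>t\<close> and 1 with weights \<open>p\<close> and
  \<open>1 - p\<close>; the right side is the tangent at 1 of the concave power.\<close>

lemma powr_le_tangent_at_1:
  fixes t p :: real
  assumes "0 \<le> t" "0 < p" "p \<le> 1"
  shows "t powr p \<le> p * t + (1 - p)"
proof (cases "t = 0")
  case False
  then show ?thesis
    using Youngs_inequality_0[of p "1 - p" t 1] assms by simp
qed (use assms in auto)

text \<open>Jensen for a concave power: once divided by their mean \<open>m\<close>, the entries
  average 1, so their tangent bounds at 1 add up to exactly \<open>card I\<close>.\<close>

lemma sum_powr_le_powr_sum:
  fixes x :: "'a \<Rightarrow> real"
  assumes p: "0 < p" "p \<le> 1" and x: "\<And>i. i \<in> I \<Longrightarrow> 0 \<le> x i"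
  shows "(\<Sum>i\<in>I. x i powr p) \<le> real (card I) powr (1 - p) * (\<Sum>i\<in>I. x i) powr p"
\<comment> \<open>No positive mean to divide by: either all entries vanish, or the sums over an
  infinite set default to 0.\<close>
proof (cases "(\<Sum>i\<in>I. x i) = 0 \<or> infinite I")
  case True
  then have "(\<Sum>i\<in>I. x i powr p) = 0"
    using x p by (cases "finite I") (auto simp: sum_nonneg_eq_0_iff)
  then show ?thesis by simp
next
  case False
  define S where "S = (\<Sum>i\<in>I. x i)"
  define n where "n = real (card I)"
  have fin: "finite I" and S: "0 < S"
    using False x by (auto simp: S_def less_le intro!: sum_nonneg)
  have "I \<noteq> {}" using S by (auto simp: S_def)
  then have n: "0 < n" using fin by (simp add: n_def card_gt_0_iff)
  define m where "m = S / n"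
  have m: "0 < m" using S n by (simp add: m_def)
  have "(\<Sum>i\<in>I. x i powr p) = m powr p * (\<Sum>i\<in>I. (x i / m) powr p)"
    using m x by (simp add: powr_divide sum_distrib_left)
  also have "(\<Sum>i\<in>I. (x i / m) powr p) \<le> (\<Sum>i\<in>I. p * (x i / m) + (1 - p))"
    using m x p by (intro sum_mono powr_le_tangent_at_1) auto
  also have "\<dots> = p * (S / m) + n * (1 - p)"
    by (simp add: sum.distrib sum_distrib_left[symmetric] sum_divide_distrib[symmetric] S_def n_def)
  also have "\<dots> = n"
    using S n by (simp add: m_def algebra_simps)
  also have "m powr p * n = n powr (1 - p) * S powr p"
    using S n by (simp add: m_def powr_divide powr_diff)
  finally show ?thesis using m by (simp add: S_def n_def mult_left_mono)
qed

lemma Psi_nonneg: "0 \<le> Psi p q \<beta> k"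
  by (simp add: Psi_def)

lemma T2_le_T1:
  assumes "0 < p" "p \<le> 1" "1 < q" "0 < \<beta>" "1 \<le> k"
  shows "T2 p q \<beta> k \<le> T1 p q \<beta> k"
proof -
  define z where "z = z0 p q \<beta> k"
  define K where "K = real k"
  define e where "e = 2 / min q 2 - (2 - 2 * p) / q"
  define S where "S = \<beta> * (1 + z) * K powr (- (1 / p)) + K powr (- (1 / q))"
  have z: "0 \<le> z" using z0_zero(1)[OF assms] by (simp add: z_def)
  have K: "0 < K" using assms by (simp add: K_def)
  \<comment> \<open>Splitting \<open>S\<close> into three summands gives \<open>card\<close> 3, the
    source of the factor 3 in \<open>T1\<close>.\<close>
  let ?x = "\<lambda>i. [\<beta> * K powr (- (1 / p)), \<beta> * z * K powr (- (1 / p)), K powr (- (1 / q))] ! i"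
  have I: "{..<3::nat} = {0, 1, 2}" by auto
  have "(K powr (- (1 / p))) powr p = 1 / K"
    unfolding powr_powr using assms K by (simp add: powr_minus_divide)
  moreover have "(K powr (- (1 / q))) powr p = K powr ((q - p) / q) / K"
  proof -
    have "- (1 / q) * p = (q - p) / q - 1" using assms by (simp add: field_simps)
    then show ?thesis using K by (simp add: powr_powr powr_diff)
  qed
  ultimately have "Psi p q \<beta> k / K = (\<Sum>i<3. ?x i powr p)"
    using assms z
    by (simp add: Psi_def z_def[symmetric] K_def[symmetric] I powr_mult add_divide_distrib
        distrib_left)
  also have "\<dots> \<le> real (card {..<3::nat}) powr (1 - p) * (\<Sum>i<3. ?x i) powr p"
    using assms z by (intro sum_powr_le_powr_sum) (auto simp: I)
  also have "(\<Sum>i<3. ?x i) = S" by (simp add: I S_def algebra_simps)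
  finally have le: "Psi p q \<beta> k / K \<le> 3 powr (1 - p) * S powr p" by simp
  have sq: "(a powr b)\<^sup>2 = a powr (2 * b)" for a b :: real
    by (simp add: power2_eq_square powr_add[symmetric])
  \<comment> \<open>The exponents of \<open>k\<close> in \<open>T2\<close> and \<open>T1\<close>
    differ by 2, which is absorbed by turning \<open>Psi\<close> into \<open>Psi / K\<close> under
    the square.\<close>
  have "2 / min q 2 - (2 * q + 2 - 2 * p) / q = e - 2"
    using assms by (simp add: e_def field_simps)
  then have "T2 p q \<beta> k = K powr e * (Psi p q \<beta> k / K)\<^sup>2"
    using K by (simp add: T2_def K_def[symmetric] powr_diff power_divide powr_numeral)
  also have "\<dots> \<le> K powr e * (3 powr (1 - p) * S powr p)\<^sup>2"
    using le Psi_nonneg K by (intro mult_left_mono power_mono) auto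
  also have "\<dots> = T1 p q \<beta> k"
    by (simp add: T1_def e_def S_def z_def K_def power_mult_distrib sq right_diff_distrib)
  finally show ?thesis .
qed

lemma ric_nonneg: "1 \<le> s \<Longrightarrow> 0 \<le> ric A s"
  using rip_bound_nonneg ric_minimal(1) by blast

theorem proposition5p8:
  fixes p q \<beta> \<epsilon> :: real and k :: nat and A :: "real^'n^'m"
  assumes "0 < p" and "p \<le> 1" and "1 < q" and "0 < \<beta>" and "0 \<le> \<epsilon>" and "1 \<le> k"
    and "ric A (2 * k) < 1 / sqrt (1 + T2 p q \<beta> k)"
    and "ric A (2 * k) < 1 / sqrt (1 + T1 p q \<beta> k)"
  shows "B_o p q \<beta> k \<epsilon> A \<le> B_z p q \<beta> k \<epsilon> A"
proof -
  have d: "0 \<le> ric A (2 * k)" using assms by (intro ric_nonneg) auto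
  have T: "T2 p q \<beta> k \<le> T1 p q \<beta> k" using assms by (intro T2_le_T1)
  have "0 \<le> T2 p q \<beta> k" by (simp add: T2_def)
  then have "0 < sqrt (1 + T1 p q \<beta> k)" using T by simp
  \<comment> \<open>This is the smaller of the two denominators, because \<open>T2\<close> is at
    most \<open>T1\<close> and the isometry constant is nonnegative; so both are positive.\<close>
  then have "0 < 1 - ric A (2 * k) * sqrt (1 + T1 p q \<beta> k)"
    using assms(8) by (simp add: pos_less_divide_eq)
  moreover have "ric A (2 * k) * sqrt (1 + T2 p q \<beta> k) \<le> ric A (2 * k) * sqrt (1 + T1 p q \<beta> k)"
    using d T by (intro mult_left_mono) auto
  ultimately show ?thesis
    unfolding B_o_def B_z_def
    using d assms(5) Psi_nonneg
    by (intro divide_left_mono mult_nonneg_nonneg add_nonneg_nonneg mult_pos_pos) auto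
qed

end
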